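(* Let $A\in\mathbb{C}^{n\times n}$ be stable, i.e., every eigenvalue $\lambda$ of $A$ satisfies $\operatorname{Re}\lambda<0$. Let $\mu_1\ge\mu_2\ge\cdots\ge\mu_n$ be the (real) eigenvalues, counted with multiplicity, of the Hermitian part $H=\tfrac12(A+A^* )$, and for $1\le j\le n$ set $$M_j=\frac{\mu_1+\cdots+\mu_j}{j}.$$ Let $p$ denote the largest integer in $\{1,\dots,n\}$ such that $M_p\ge 0$, taking $p=0$ if $M_1<0$. Then for every $k$ with $1\le k\le n$ and every $V\in\mathbb{C}^{n\times k}$ with orthonormal columns ($V^*V=I$), the matrix $V^*AV\in\mathbb{C}^{k\times k}$ has at most $p$ eigenvalues (counted with algebraic multiplicity) with nonnegative real part.
   Context: $A^*$ denotes the conjugate transpose. The matrix $V^*AV$ is the state matrix of the order-$k$ reduced-order model obtained by orthogonal (Galerkin) projection of the continuous-time system $\dot{x}(t)=Ax(t)+bu(t)$ onto the range of $V$; its eigenvalues with nonnegative real part are called unstable modes. No assumption is made on the subspace $\operatorname{range}(V)$. *)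

theory Defs
  imports "Jordan_Normal_Form.Schur_Decomposition"
begin

definition stable_mat :: "complex mat \<Rightarrow> bool" where
  "stable_mat A \<longleftrightarrow> (\<forall>z. eigenvalue A z \<longrightarrow> Re z < 0)"

definition hermitian_part :: "complex mat \<Rightarrow> complex mat" where
  "hermitian_part A = (1/2) \<cdot>\<^sub>m (A + mat_adjoint A)"

text \<open>Eigenvalues counted with algebraic multiplicity; meaningful for square matrices,
  whose characteristic polynomial is monic, hence nonzero.\<close>

definition eigenvalues_mset :: "complex mat \<Rightarrow> complex multiset" where
  "eigenvalues_mset A = proots (char_poly A)"

lemma set_eigenvalues_mset:
  assumes "A \<in> carrier_mat n n"
  shows "set_mset (eigenvalues_mset A) = {z. eigenvalue A z}"
proof -
  have "char_poly A \<noteq> 0"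
    using degree_monic_char_poly[OF assms] by auto
  then show ?thesis
    by (simp add: eigenvalues_mset_def eigenvalue_root_char_poly[OF assms])
qed

definition num_unstable_modes :: "complex mat \<Rightarrow> nat" where
  "num_unstable_modes A = size {#z \<in># eigenvalues_mset A. Re z \<ge> 0#}"

end

theory Submission
  imports Defs
begin

text \<open>
  A unitary Schur form of \<open>V\<^sup>* A V\<close> that lists the \<open>m\<close> unstable eigenvalues first shows
  that their sum is the trace of a compression \<open>W\<^sup>* A W\<close> of \<open>A\<close> to an \<open>m\<close>-dimensional subspace.
  Its real part is nonnegative and equals the trace of \<open>W\<^sup>* H W\<close>, which by Ky Fan's maximum
  principle is at most \<open>\<mu>\<^sub>1 + \<dots> + \<mu>\<^sub>m\<close>. Hence \<open>M\<^sub>m \<ge> 0\<close>, so \<open>m \<le> p\<close>.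
\<close>

section \<open>Entrywise rules for adjoints and products\<close>

lemma dim_mat_adjoint [simp]:
  "dim_row (mat_adjoint A) = dim_col A" "dim_col (mat_adjoint A) = dim_row A"
  by (auto simp: mat_adjoint_def)

lemma index_mat_adjoint [simp]:
  fixes A :: "complex mat"
  assumes "i < dim_col A" "j < dim_row A"
  shows "mat_adjoint A $$ (i, j) = cnj (A $$ (j, i))"
  using assms by (simp add: mat_adjoint_def mat_of_rows_index)

lemma mat_adjoint_carrier:
  "A \<in> carrier_mat n m \<Longrightarrow> mat_adjoint A \<in> carrier_mat m n"
  by (intro carrier_matI) auto

lemma index_mult_mat_sum:
  assumes "A \<in> carrier_mat n m" "B \<in> carrier_mat m l" "i < n" "j < l"
  shows "(A * B) $$ (i, j) = (\<Sum>r<m. A $$ (i, r) * B $$ (r, j))"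
  using assms by (auto simp: scalar_prod_def atLeast0LessThan intro!: sum.cong)

lemma mat_adjoint_mult:
  fixes A B :: "complex mat"
  assumes "A \<in> carrier_mat n m" "B \<in> carrier_mat m l"
  shows "mat_adjoint (A * B) = mat_adjoint B * mat_adjoint A"
proof (rule eq_matI)
  fix i j
  assume "i < dim_row (mat_adjoint B * mat_adjoint A)" "j < dim_col (mat_adjoint B * mat_adjoint A)"
  then have i: "i < l" and j: "j < n" using assms by auto
  have "mat_adjoint (A * B) $$ (i, j) = cnj ((A * B) $$ (j, i))"
    using i j assms by (intro index_mat_adjoint) auto
  also have "\<dots> = (\<Sum>r<m. mat_adjoint B $$ (i, r) * mat_adjoint A $$ (r, j))"
    using i j assms by (simp add: index_mult_mat_sum[OF assms] mult.commute del: index_mult_mat)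
  also have "\<dots> = (mat_adjoint B * mat_adjoint A) $$ (i, j)"
    using i j assms by (subst index_mult_mat_sum[of _ l m _ n]) auto
  finally show "mat_adjoint (A * B) $$ (i, j) = (mat_adjoint B * mat_adjoint A) $$ (i, j)" .
qed (use assms in auto)

lemma mat_adjoint_adjoint [simp]:
  fixes A :: "complex mat"
  shows "mat_adjoint (mat_adjoint A) = A"
  by (rule eq_matI) auto

lemma mat_adjoint_four_block:
  fixes A B C D :: "complex mat"
  assumes "A \<in> carrier_mat a b" "B \<in> carrier_mat a d" "C \<in> carrier_mat c b" "D \<in> carrier_mat c d"
  shows "mat_adjoint (four_block_mat A B C D) =
    four_block_mat (mat_adjoint A) (mat_adjoint C) (mat_adjoint B) (mat_adjoint D)"
  by (rule eq_matI) (use assms in auto)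

section \<open>Unitary completion and unitary Schur form\<close>

text \<open>Dividing each column by its Euclidean norm turns orthogonal columns into orthonormal
  ones. The division is legitimate because \<open>corthogonal_mat\<close> also demands that every
  column have nonzero inner product with itself.\<close>

lemma unitary_of_corthogonal:
  fixes W :: "complex mat"
  assumes W: "W \<in> carrier_mat n n" and orth: "corthogonal_mat W"
  defines "U \<equiv> mat n n (\<lambda>(i, j). W $$ (i, j) / of_real (sqrt (\<Sum>r<n. (cmod (W $$ (r, j)))\<^sup>2)))"
  shows "mat_adjoint U * U = 1\<^sub>m n"
proof (rule eq_matI)
  define s where "s j = (\<Sum>r<n. (cmod (W $$ (r, j)))\<^sup>2)" for j
  have U: "U \<in> carrier_mat n n" by (simp add: U_def)
  fix i j assume "i < dim_row (1\<^sub>m n :: complex mat)" "j < dim_col (1\<^sub>m n :: complex mat)"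
  then have ij: "i < n" "j < n" by auto
  have gram: "(\<Sum>r<n. cnj (W $$ (r, i)) * W $$ (r, j)) = col W j \<bullet>c col W i"
    using W ij by (auto simp: scalar_prod_def atLeast0LessThan mult.commute intro!: sum.cong)
  have nn: "cnj z * z = of_real ((cmod z)\<^sup>2)" for z :: complex
    by (metis complex_norm_square mult.commute)
  have "(mat_adjoint U * U) $$ (i, j) =
      (\<Sum>r<n. cnj (W $$ (r, i)) * W $$ (r, j)) / (of_real (sqrt (s i)) * of_real (sqrt (s j)))"
    using ij U by (subst index_mult_mat_sum[of _ n n _ n])
      (auto simp: U_def s_def sum_divide_distrib intro!: sum.cong)
  also have "\<dots> = (if i = j then 1 else 0)"
  proof (cases "i = j")
    case True
    have "(\<Sum>r<n. cnj (W $$ (r, j)) * W $$ (r, j)) = of_real (s j)"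
      by (simp add: s_def nn)
    moreover from this have "s j \<noteq> 0"
      using gram True corthogonal_matD[OF orth, of j j] W ij by auto
    moreover have "s j \<ge> 0" by (auto simp: s_def intro: sum_nonneg)
    ultimately show ?thesis using True
      by (simp flip: of_real_mult)
  next
    case False
    then show ?thesis using gram corthogonal_matD[OF orth, of j i] W ij by auto
  qed
  finally show "(mat_adjoint U * U) $$ (i, j) = 1\<^sub>m n $$ (i, j)" using ij by simp
qed (simp_all add: U_def)

text \<open>Complete \<open>v\<close> to a basis, apply Gram-Schmidt, which leaves the first vector
  unchanged, and normalise. The scalar \<open>c\<close> is the reciprocal of the norm of
  \<open>v\<close>; its value is left open because any multiple of an eigenvector satisfies the same
  eigenvalue equation.\<close>

lemma unitary_completion:
  fixes v :: "complex vec"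
  assumes v: "v \<in> carrier_vec n" "v \<noteq> 0\<^sub>v n"
  obtains U c where "U \<in> carrier_mat n n" "mat_adjoint U * U = 1\<^sub>m n" "col U 0 = c \<cdot>\<^sub>v v"
proof -
  have n: "n > 0" using v by (cases n) auto
  define b where "b = basis_completion v"
  define ws where "ws = gram_schmidt n b"
  define W where "W = mat_of_cols n ws"
  interpret cof_vec_space n "TYPE(complex)" .
  note b = basis_completion[OF v, folded b_def]
  from b n obtain vs where bv: "b = v # vs" by (cases b) auto
  have ws: "set ws \<subseteq> carrier_vec n" "corthogonal ws" "length ws = n"
    using gram_schmidt_result[OF _ _ _ refl, of b, folded ws_def] b by auto
  have hd: "hd ws = v" using gram_schmidt_hd[OF v(1), of vs, folded bv] by (simp add: ws_def)
  have W: "W \<in> carrier_mat n n" using ws by (auto simp: W_def)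
  have orth: "corthogonal_mat W" using orthogonal_mat_of_cols ws by (simp add: W_def)
  have "ws \<noteq> []" using ws n by auto
  with hd have "ws ! 0 = v" by (simp add: hd_conv_nth)
  then have W0: "W $$ (i, 0) = v $ i" if "i < n" for i
    using that n ws by (simp add: W_def mat_of_cols_index)
  define U where
    "U = mat n n (\<lambda>(i, j). W $$ (i, j) / of_real (sqrt (\<Sum>r<n. (cmod (W $$ (r, j)))\<^sup>2)))"
  have "col U 0 = (1 / of_real (sqrt (\<Sum>r<n. (cmod (W $$ (r, 0)))\<^sup>2))) \<cdot>\<^sub>v v"
    using n v W0 by (intro eq_vecI) (auto simp: U_def)
  then show thesis
    using that[of U] unitary_of_corthogonal[OF W orth] by (simp add: U_def)
qed

text \<open>In the library's \<open>schur_decomposition\<close> the transformation is invertible but in general not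
  unitary, since its factors have orthogonal columns that are not normalised.\<close>

lemma unitary_schur:
  fixes A :: "complex mat"
  assumes "A \<in> carrier_mat n n" "char_poly A = (\<Prod>e\<leftarrow>es. [:- e, 1:])"
  shows "\<exists>P T. P \<in> carrier_mat n n \<and> T \<in> carrier_mat n n \<and> mat_adjoint P * P = 1\<^sub>m n \<and>
    mat_adjoint P * A * P = T \<and> upper_triangular T \<and> diag_mat T = es"
  using assms
proof (induction es arbitrary: n A)
  case Nil
  \<comment> \<open>The empty product is 1, whereas the characteristic polynomial has degree
    \<open>n\<close>.\<close>
  with degree_monic_char_poly[of A n] have "n = 0" by auto
  with Nil show ?case
    by (intro exI[of _ A]) (auto simp: diag_mat_def)
next
  case (Cons e es n A)
  let ?n1 = "n - 1"
  from Cons.prems have A: "A \<in> carrier_mat n n" by simp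
  from Cons.prems have cp: "char_poly A = [: -e, 1 :] * (\<Prod>e \<leftarrow> es. [:- e, 1:])" by auto
  have e: "eigenvalue A e"
    unfolding eigenvalue_root_char_poly[OF A] cp by simp
  then obtain v where v: "v \<in> carrier_vec n" "v \<noteq> 0\<^sub>v n" and ev: "A *\<^sub>v v = e \<cdot>\<^sub>v v"
    using A by (auto simp: eigenvalue_def eigenvector_def)
  then have n: "n > 0" by (cases n) auto
  obtain U c where U: "U \<in> carrier_mat n n" and UU: "mat_adjoint U * U = 1\<^sub>m n"
    and U0: "col U 0 = c \<cdot>\<^sub>v v"
    using unitary_completion[OF v] by blast
  have U': "mat_adjoint U \<in> carrier_mat n n" using U by (simp add: mat_adjoint_carrier)
  have UU': "U * mat_adjoint U = 1\<^sub>m n" using mat_mult_left_right_inverse[OF U' U UU] .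
  define C where "C = mat_adjoint U * A * U"
  have C: "C \<in> carrier_mat n n"
    unfolding C_def by (intro mult_carrier_mat[OF mult_carrier_mat[OF U' A] U])
  have sim: "similar_mat C A"
    by (rule similar_matI[OF _ UU UU' C_def]) (use U U' A C in auto)
  \<comment> \<open>The first column of \<open>U\<close> is a multiple of the eigenvector
    \<open>v\<close>, so \<open>A\<close> scales it by \<open>e\<close>, and
    \<open>mat_adjoint U\<close> sends it to the first unit vector. Hence \<open>C\<close> has
    \<open>e\<close> in its corner and zeros below, and the induction continues with the trailing
    block \<open>A3\<close>.\<close>
  have "col C 0 = mat_adjoint U *\<^sub>v (A *\<^sub>v col U 0)"
    unfolding C_def assoc_mult_mat[OF U' A U] col_mult2[OF U' mult_carrier_mat[OF A U] n]
      col_mult2[OF A U n] ..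
  also have "A *\<^sub>v col U 0 = e \<cdot>\<^sub>v col U 0"
    unfolding U0 using A v ev by (simp add: mult_mat_vec smult_smult_assoc mult.commute)
  also have "mat_adjoint U *\<^sub>v (e \<cdot>\<^sub>v col U 0) = e \<cdot>\<^sub>v (mat_adjoint U *\<^sub>v col U 0)"
    by (rule mult_mat_vec[OF U']) (use U n in auto)
  also have "mat_adjoint U *\<^sub>v col U 0 = unit_vec n 0"
    using n by (subst col_mult2[OF U' U, symmetric]) (auto simp: UU)
  finally have col0: "col C 0 = e \<cdot>\<^sub>v unit_vec n 0" .
  have C0: "C $$ (i, 0) = (if i = 0 then e else 0)" if "i < n" for i
    using arg_cong[OF col0, of "\<lambda>w. w $ i"] that n C by (auto simp: unit_vec_def)
  obtain A1 A2 A0 A3 where split: "split_block C 1 1 = (A1, A2, A0, A3)"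
    by (cases "split_block C 1 1") auto
  have "dim_row C = 1 + ?n1" "dim_col C = 1 + ?n1" using C n by auto
  note sb = split_block[OF split this]
  have A1: "A1 = mat 1 1 (\<lambda>_. e)"
    using split[unfolded split_block_def Let_def] C0 n by auto
  have A0: "A0 = 0\<^sub>m ?n1 1"
    using split[unfolded split_block_def Let_def] C0 C by auto
  note A2 = sb(2) and A3 = sb(4)
  have A1c: "A1 \<in> carrier_mat 1 1" and A0c: "A0 \<in> carrier_mat ?n1 1" using sb by auto
  have Cb: "C = four_block_mat A1 A2 (0\<^sub>m ?n1 1) A3" using sb(5) A0 by simp
  have "char_poly A1 * char_poly A3 = [: -e,1 :] * (\<Prod>e\<leftarrow>es. [:- e, 1:])"
    using char_poly_similar[OF sim] char_poly_four_block_zeros_col[OF A1c A2 A3] cp Cb by simp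
  moreover have "char_poly A1 = [: -e,1 :]"
    by (simp add: A1 char_poly_defs det_def sign_def)
  ultimately have "char_poly A3 = (\<Prod>e\<leftarrow>es. [:- e, 1:])"
    by (metis mult_cancel_left pCons_eq_0_iff zero_neq_one)
  from Cons.IH[OF A3 this] obtain P T where P: "P \<in> carrier_mat ?n1 ?n1" and T: "T \<in> carrier_mat ?n1 ?n1"
    and PP: "mat_adjoint P * P = 1\<^sub>m ?n1" and PT: "mat_adjoint P * A3 * P = T"
    and ut: "upper_triangular T" and dg: "diag_mat T = es" by blast
  \<comment> \<open>The unitary \<open>P\<close> for the trailing block is extended by a leading 1.
    Conjugation by \<open>F\<close> then keeps the first column of \<open>C\<close> and
    triangularises the rest, so \<open>U * F\<close> is the required unitary for
    \<open>A\<close>.\<close>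
  define F where "F = four_block_mat (1\<^sub>m 1) (0\<^sub>m 1 ?n1) (0\<^sub>m ?n1 1) P"
  have adj1: "mat_adjoint (1\<^sub>m 1 :: complex mat) = 1\<^sub>m 1" by (rule eq_matI) auto
  have adj0: "mat_adjoint (0\<^sub>m a b :: complex mat) = 0\<^sub>m b a" for a b by (rule eq_matI) auto
  have F': "mat_adjoint F = four_block_mat (1\<^sub>m 1) (0\<^sub>m 1 ?n1) (0\<^sub>m ?n1 1) (mat_adjoint P)"
    unfolding F_def by (subst mat_adjoint_four_block[of _ 1 1 _ ?n1 _ ?n1]) (use P adj1 adj0 in auto)
  have Fc: "F \<in> carrier_mat n n" using P n by (auto simp: F_def)
  then have F'c: "mat_adjoint F \<in> carrier_mat n n" by (rule mat_adjoint_carrier)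
  have P': "mat_adjoint P \<in> carrier_mat ?n1 ?n1" using P by (simp add: mat_adjoint_carrier)
  have "mat_adjoint F * F = four_block_mat (1\<^sub>m 1) (0\<^sub>m 1 ?n1) (0\<^sub>m ?n1 1) (1\<^sub>m ?n1)"
    unfolding F' unfolding F_def
    by (subst mult_four_block_mat[of _ 1 1 _ ?n1 _ ?n1 _ _ 1 _ ?n1]) (use P P' PP in auto)
  also have "\<dots> = 1\<^sub>m n" using n by (intro eq_matI) auto
  finally have FF: "mat_adjoint F * F = 1\<^sub>m n" .
  have "mat_adjoint F * C = four_block_mat A1 A2 (0\<^sub>m ?n1 1) (mat_adjoint P * A3)"
    unfolding F' Cb
    by (subst mult_four_block_mat[of _ 1 1 _ ?n1 _ ?n1 _ _ 1 _ ?n1]) (use A1c A2 A3 P' right_mult_zero_mat[OF P', of 1] in auto)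
  also have "\<dots> * F = four_block_mat A1 (A2 * P) (0\<^sub>m ?n1 1) T"
    unfolding F_def
    by (subst mult_four_block_mat[of _ 1 1 _ ?n1 _ ?n1 _ _ 1 _ ?n1])
       (use A1c A2 A3 P P' PT in \<open>auto simp del: assoc_mult_mat\<close>)
  finally have FCF: "mat_adjoint F * C * F = four_block_mat A1 (A2 * P) (0\<^sub>m ?n1 1) T" .
  have adjUF: "mat_adjoint (U * F) = mat_adjoint F * mat_adjoint U"
    by (rule mat_adjoint_mult[OF U Fc])
  have UF: "U * F \<in> carrier_mat n n" using U Fc by simp
  have "mat_adjoint (U * F) * (U * F) = mat_adjoint F * ((mat_adjoint U * U) * F)"
    unfolding adjUF using U' U Fc F'c
    by (simp add: assoc_mult_mat[of _ n n _ n _ n])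
  also have "\<dots> = 1\<^sub>m n" using UU FF Fc by simp
  finally have unit: "mat_adjoint (U * F) * (U * F) = 1\<^sub>m n" .
  have "mat_adjoint (U * F) * A * (U * F) = mat_adjoint F * C * F"
    unfolding adjUF C_def using U' U Fc F'c A
    by (simp add: assoc_mult_mat[of _ n n _ n _ n])
  then have conj: "mat_adjoint (U * F) * A * (U * F) = four_block_mat A1 (A2 * P) (0\<^sub>m ?n1 1) T"
    using FCF by simp
  have "upper_triangular (four_block_mat A1 (A2 * P) (0\<^sub>m ?n1 1) T)"
    by (intro upper_triangular_four_block[OF _ T _ ut]) (auto simp: A1)
  moreover have "diag_mat (four_block_mat A1 (A2 * P) (0\<^sub>m ?n1 1) T) = e # es"
    using diag_four_block_mat[OF A1c T] dg by (simp add: A1 diag_mat_def)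
  moreover have "four_block_mat A1 (A2 * P) (0\<^sub>m ?n1 1) T \<in> carrier_mat n n"
    using A1c T n by auto
  ultimately show ?case
    using UF unit conj by blast
qed

section \<open>Eigenvalue lists and Hermitian diagonalisation\<close>

text \<open>Over the complex numbers the characteristic polynomial splits, and the product of linear
  factors depends only on the multiset of roots. Thus every ordering \<open>es\<close> of the
  eigenvalues may be prescribed as the diagonal of a Schur form.\<close>

lemma char_poly_of_eigenvalues_mset:
  assumes A: "A \<in> carrier_mat n n" and es: "mset es = eigenvalues_mset A"
  shows "char_poly A = (\<Prod>e\<leftarrow>es. [:- e, 1:])"
proof -
  obtain as where as: "char_poly A = (\<Prod>a\<leftarrow>as. [:- a, 1:])"
    using char_poly_factorized[OF A] by blast
  have "proots (\<Prod>a\<leftarrow>as. [:- a, 1:]) = mset as"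
  proof (induction as)
    case (Cons a as)
    have "(\<Prod>a\<leftarrow>as. [:- a, 1:]) \<noteq> 0" by (auto simp: prod_list_zero_iff)
    then show ?case using Cons by (simp add: proots_mult del: mult_pCons_left)
  qed simp
  then have "mset as = mset es" using as es by (simp add: eigenvalues_mset_def)
  then have "prod_mset (mset (map (\<lambda>a. [:- a, 1:]) as)) = prod_mset (mset (map (\<lambda>a. [:- a, 1:]) es))"
    by simp
  then show ?thesis using as by (simp only: prod_mset_prod_list)
qed

text \<open>Unitary conjugation preserves being Hermitian, so the Schur form is Hermitian as well as
  upper triangular, and therefore diagonal. Its diagonal follows the order of
  \<open>es\<close>.\<close>

lemma hermitian_diagonalisation:
  assumes H: "H \<in> carrier_mat n n" "mat_adjoint H = H" and es: "mset es = eigenvalues_mset H"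
  obtains P where "P \<in> carrier_mat n n" "mat_adjoint P * P = 1\<^sub>m n"
    "\<And>i j. i < n \<Longrightarrow> j < n \<Longrightarrow> (mat_adjoint P * H * P) $$ (i, j) = (if i = j then es ! i else 0)"
proof -
  obtain P T where P: "P \<in> carrier_mat n n" and T: "T \<in> carrier_mat n n"
    and PP: "mat_adjoint P * P = 1\<^sub>m n" and PT: "mat_adjoint P * H * P = T"
    and ut: "upper_triangular T" and dg: "diag_mat T = es"
    using unitary_schur[OF H(1) char_poly_of_eigenvalues_mset[OF H(1) es]] by blast
  have P': "mat_adjoint P \<in> carrier_mat n n" using P by (simp add: mat_adjoint_carrier)
  have "mat_adjoint T = T"
    unfolding PT[symmetric] using mat_adjoint_mult[OF mult_carrier_mat[OF P' H(1)] P]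
      mat_adjoint_mult[OF P' H(1)] P P' H by (simp add: assoc_mult_mat[of _ n n _ n _ n])
  then have sym: "T $$ (i, j) = cnj (T $$ (j, i))" if "i < n" "j < n" for i j
    using that T index_mat_adjoint[of i T j] by auto
  have low: "T $$ (i, j) = 0" if "j < i" "i < n" for i j
    using ut that T by auto
  have "T $$ (i, j) = (if i = j then es ! i else 0)" if "i < n" "j < n" for i j
    using that dg T sym[of i j] low[of i j] low[of j i]
    by (cases i j rule: linorder_cases) (auto simp: diag_mat_def)
  with that P PP PT show thesis by blast
qed

section \<open>Ky Fan's maximum principle\<close>

text \<open>Weights bounded by 1 with total mass \<open>m\<close> do best when they are all placed
  on the first \<open>m\<close> indices, where \<mu> is largest.\<close>

lemma weighted_sum_le_sum_largest:
  fixes \<mu> c :: "nat \<Rightarrow> real"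
  assumes anti: "\<And>i j. i \<le> j \<Longrightarrow> j < n \<Longrightarrow> \<mu> j \<le> \<mu> i"
    and c: "\<And>j. j < n \<Longrightarrow> 0 \<le> c j" "\<And>j. j < n \<Longrightarrow> c j \<le> 1"
    and sum: "(\<Sum>j<n. c j) = real m"
  shows "(\<Sum>j<n. \<mu> j * c j) \<le> (\<Sum>j<m. \<mu> j)"
proof (cases m)
  case 0
  \<comment> \<open>This case is separate because the threshold used below is the value of \<mu> at
    index \<open>m - 1\<close>.\<close>
  have "c j = 0" if "j < n" for j
    using sum_nonneg_0[of "{..<n}" c j] sum c 0 that by auto
  then show ?thesis using 0 by simp
next
  case (Suc l)
  have "(\<Sum>j<n. c j) \<le> (\<Sum>j<n. 1)" by (intro sum_mono) (use c in auto)
  then have mn: "m \<le> n" using sum by simp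
  \<comment> \<open>Shifting by \<open>\<mu> l\<close> with \<open>l = m - 1\<close> makes the
    comparison termwise: before index \<open>m\<close> the factor is nonnegative and the weight at
    most 1, afterwards the factor is nonpositive and the weight nonnegative. Both sides have total
    weight \<open>m\<close>, so the shift cancels at the end.\<close>
  have "(\<Sum>j<n. (\<mu> j - \<mu> l) * c j) \<le> (\<Sum>j<n. if j < m then \<mu> j - \<mu> l else 0)"
  proof (rule sum_mono)
    fix j assume "j \<in> {..<n}"
    then have j: "j < n" by simp
    show "(\<mu> j - \<mu> l) * c j \<le> (if j < m then \<mu> j - \<mu> l else 0)"
    proof (cases "j < m")
      case True
      then have "0 \<le> \<mu> j - \<mu> l" using anti[of j l] Suc mn by simp
      then show ?thesis using True c(2)[OF j] mult_left_le by fastforce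
    next
      case False
      then have "\<mu> j - \<mu> l \<le> 0" using anti[of l j] Suc j by simp
      from mult_nonpos_nonneg[OF this c(1)[OF j]] show ?thesis using False by simp
    qed
  qed
  also have "\<dots> = (\<Sum>j<m. \<mu> j - \<mu> l)"
    by (rule sum.mono_neutral_cong_right) (use mn in auto)
  finally show ?thesis
    using sum by (simp add: left_diff_distrib sum_subtractf flip: sum_distrib_left)
qed

text \<open>\<open>Q = Y Y\<^sup>*\<close> is a Hermitian projection, so its diagonal entries satisfy
  \<open>q = \<Sum>\<^sub>l \<bar>Q\<^sub>j\<^sub>l\<bar>\<^sup>2 \<ge> q\<^sup>2\<close>.\<close>

lemma orthonormal_row_norm_le_1:
  fixes Y :: "complex mat"
  assumes Y: "Y \<in> carrier_mat n k" "mat_adjoint Y * Y = 1\<^sub>m k" and j: "j < n"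
  shows "(\<Sum>i<k. (cmod (Y $$ (j, i)))\<^sup>2) \<le> 1"
proof -
  define Q where "Q = Y * mat_adjoint Y"
  define q where "q = (\<Sum>i<k. (cmod (Y $$ (j, i)))\<^sup>2)"
  have Y': "mat_adjoint Y \<in> carrier_mat k n" using Y by (simp add: mat_adjoint_carrier)
  have Q: "Q \<in> carrier_mat n n" using Y Y' by (simp add: Q_def)
  have Q': "mat_adjoint Q = Q"
    using mat_adjoint_mult[OF Y(1) Y'] by (simp add: Q_def)
  have "Q * Q = Y * ((mat_adjoint Y * Y) * mat_adjoint Y)"
    unfolding Q_def assoc_mult_mat[OF Y(1) Y' Q[unfolded Q_def]] assoc_mult_mat[OF Y' Y(1) Y'] ..
  also have "\<dots> = Q" unfolding Y(2) Q_def left_mult_one_mat[OF Y'] ..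
  finally have idem: "Q * Q = Q" .
  have qj: "Q $$ (j, j) = of_real q"
    unfolding Q_def q_def using Y j
    by (subst index_mult_mat_sum[OF Y(1) Y' j j])
      (auto simp: complex_norm_square simp del: of_real_power intro!: sum.cong)
  have "Q $$ (j, j) = (\<Sum>l<n. Q $$ (j, l) * cnj (Q $$ (j, l)))"
  proof -
    have "Q $$ (j, j) = (\<Sum>l<n. Q $$ (j, l) * Q $$ (l, j))"
      using index_mult_mat_sum[OF Q Q j j] idem by simp
    also have "\<dots> = (\<Sum>l<n. Q $$ (j, l) * cnj (Q $$ (j, l)))"
    proof (rule sum.cong)
      fix l assume "l \<in> {..<n}"
      then have "mat_adjoint Q $$ (l, j) = cnj (Q $$ (j, l))"
        using Q j by (intro index_mat_adjoint) auto
      then show "Q $$ (j, l) * Q $$ (l, j) = Q $$ (j, l) * cnj (Q $$ (j, l))"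
        using Q' by simp
    qed simp
    finally show ?thesis .
  qed
  also have "\<dots> = of_real (\<Sum>l<n. (cmod (Q $$ (j, l)))\<^sup>2)"
    by (simp add: complex_norm_square del: of_real_power)
  finally have "q = (\<Sum>l<n. (cmod (Q $$ (j, l)))\<^sup>2)"
    using qj by (simp only: of_real_eq_iff)
  \<comment> \<open>Only the diagonal term \<open>l = j\<close> is kept.\<close>
  also have "\<dots> \<ge> (cmod (Q $$ (j, j)))\<^sup>2"
    by (rule member_le_sum) (use j in auto)
  finally have "q\<^sup>2 \<le> q" using qj by simp
  moreover have "q \<ge> 0" by (auto simp: q_def intro: sum_nonneg)
  ultimately show ?thesis unfolding q_def[symmetric]
    by (cases "q = 0") (auto simp: power2_eq_square mult_le_cancel_right1)
qed

text \<open>In an eigenbasis of \<open>H\<close> the partial trace is \<open>\<Sum>\<^sub>j \<mu>\<^sub>j c\<^sub>j\<close> with weights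
  \<open>0 \<le> c\<^sub>j \<le> 1\<close> of total mass \<open>m\<close>.\<close>

lemma ky_fan_trace_le:
  fixes H Z :: "complex mat" and \<mu> :: "nat \<Rightarrow> real"
  assumes H: "H \<in> carrier_mat n n" "mat_adjoint H = H"
    and \<mu>: "mset (map (\<lambda>j. complex_of_real (\<mu> j)) [0..<n]) = eigenvalues_mset H"
    and anti: "\<And>i j. i \<le> j \<Longrightarrow> j < n \<Longrightarrow> \<mu> j \<le> \<mu> i"
    and Z: "Z \<in> carrier_mat n k" "mat_adjoint Z * Z = 1\<^sub>m k"
    and m: "m \<le> k"
  shows "(\<Sum>i<m. Re ((mat_adjoint Z * H * Z) $$ (i, i))) \<le> (\<Sum>j<m. \<mu> j)"
proof -
  obtain P where P: "P \<in> carrier_mat n n" and PP: "mat_adjoint P * P = 1\<^sub>m n"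
    and PD: "\<And>i j. i < n \<Longrightarrow> j < n \<Longrightarrow> (mat_adjoint P * H * P) $$ (i, j) =
      (if i = j then map (\<lambda>j. complex_of_real (\<mu> j)) [0..<n] ! i else 0)"
    using hermitian_diagonalisation[OF H \<mu>] by blast
  define D where "D = mat_adjoint P * H * P"
  \<comment> \<open>The columns of \<open>Y\<close> are the coordinates of the columns of
    \<open>Z\<close> in the orthonormal eigenbasis given by \<open>P\<close>; they remain
    orthonormal.\<close>
  define Y where "Y = mat_adjoint P * Z"
  have P': "mat_adjoint P \<in> carrier_mat n n" using P by (simp add: mat_adjoint_carrier)
  have PP': "P * mat_adjoint P = 1\<^sub>m n" using mat_mult_left_right_inverse[OF P' P PP] .
  have D: "D \<in> carrier_mat n n"
    unfolding D_def by (intro mult_carrier_mat[OF mult_carrier_mat[OF P' H(1)] P])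
  have Dij: "D $$ (i, j) = (if i = j then of_real (\<mu> i) else 0)" if "i < n" "j < n" for i j
    using PD[OF that] that by (simp add: D_def)
  have Y: "Y \<in> carrier_mat n k" unfolding Y_def by (rule mult_carrier_mat[OF P' Z(1)])
  then have Y': "mat_adjoint Y \<in> carrier_mat k n" by (rule mat_adjoint_carrier)
  have Zc: "mat_adjoint Z \<in> carrier_mat k n" using Z by (simp add: mat_adjoint_carrier)
  have adjY: "mat_adjoint Y = mat_adjoint Z * P"
    using mat_adjoint_mult[OF P' Z(1)] by (simp add: Y_def)
  have PY: "P * Y = Z"
    unfolding Y_def using PP' P P' Z(1) by (simp flip: assoc_mult_mat[of P n n _ n Z k])
  have YP: "mat_adjoint Y * mat_adjoint P = mat_adjoint Z"
    using mat_adjoint_mult[OF P Y] by (simp add: PY)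
  have YY: "mat_adjoint Y * Y = 1\<^sub>m k"
  proof -
    have "mat_adjoint Y * Y = (mat_adjoint Y * mat_adjoint P) * Z"
      unfolding Y_def[symmetric] using Y' P' Z(1) by (simp add: Y_def)
    then show ?thesis using YP Z by simp
  qed
  have "mat_adjoint Y * D * Y = (mat_adjoint Y * mat_adjoint P) * H * (P * Y)"
    unfolding D_def using Y' P' P Y H(1)
    by (simp add: assoc_mult_mat[of _ k n _ n _ n] assoc_mult_mat[of _ k n _ n _ k]
        assoc_mult_mat[of _ n n _ n _ k])
  then have ZHZ: "mat_adjoint Z * H * Z = mat_adjoint Y * D * Y" by (simp add: YP PY)
  have diag: "Re ((mat_adjoint Z * H * Z) $$ (i, i)) = (\<Sum>j<n. \<mu> j * (cmod (Y $$ (j, i)))\<^sup>2)"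
    if i: "i < k" for i
  proof -
    have YD: "(mat_adjoint Y * D) $$ (i, j) = of_real (\<mu> j) * cnj (Y $$ (j, i))" if j: "j < n" for j
    proof -
      have "(mat_adjoint Y * D) $$ (i, j) = (\<Sum>l<n. mat_adjoint Y $$ (i, l) * D $$ (l, j))"
        by (rule index_mult_mat_sum[OF Y' D i j])
      also have "\<dots> = (\<Sum>l<n. if l = j then of_real (\<mu> j) * cnj (Y $$ (j, i)) else 0)"
        using Y i j by (intro sum.cong) (auto simp: Dij)
      finally show ?thesis using j by simp
    qed
    have "(mat_adjoint Y * D * Y) $$ (i, i) = (\<Sum>j<n. (mat_adjoint Y * D) $$ (i, j) * Y $$ (j, i))"
      by (rule index_mult_mat_sum[OF mult_carrier_mat[OF Y' D] Y i i])
    also have "\<dots> = (\<Sum>j<n. of_real (\<mu> j * (cmod (Y $$ (j, i)))\<^sup>2))"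
      using YD by (intro sum.cong)
        (auto simp: complex_norm_square mult_ac simp del: of_real_power index_mult_mat)
    finally show ?thesis unfolding ZHZ by (simp del: index_mult_mat)
  qed
  \<comment> \<open>The weight \<open>c j\<close> is the squared norm of the projection of the
    \<open>j\<close>-th eigenvector onto the span of the first \<open>m\<close> columns of
    \<open>Z\<close>.\<close>
  define c where "c j = (\<Sum>i<m. (cmod (Y $$ (j, i)))\<^sup>2)" for j
  have col: "(\<Sum>j<n. (cmod (Y $$ (j, i)))\<^sup>2) = 1" if i: "i < k" for i
  proof -
    have "complex_of_real (\<Sum>j<n. (cmod (Y $$ (j, i)))\<^sup>2) = (mat_adjoint Y * Y) $$ (i, i)"
      using Y i by (subst index_mult_mat_sum[OF Y' Y i i])
        (auto simp: complex_norm_square mult.commute simp del: of_real_power intro!: sum.cong)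
    also have "\<dots> = of_real 1" using YY i by simp
    finally show ?thesis by (simp only: of_real_eq_iff)
  qed
  have "(\<Sum>i<m. Re ((mat_adjoint Z * H * Z) $$ (i, i))) =
      (\<Sum>i<m. \<Sum>j<n. \<mu> j * (cmod (Y $$ (j, i)))\<^sup>2)"
    using diag m by (intro sum.cong) auto
  also have "\<dots> = (\<Sum>j<n. \<mu> j * c j)"
    by (subst sum.swap) (simp add: c_def sum_distrib_left)
  also have "\<dots> \<le> (\<Sum>j<m. \<mu> j)"
  proof (rule weighted_sum_le_sum_largest[OF anti])
    show "0 \<le> c j" for j by (auto simp: c_def intro: sum_nonneg)
    show "c j \<le> 1" if "j < n" for j
    proof -
      \<comment> \<open>Enlarging the sum from \<open>m\<close> to all \<open>k\<close> columns
        gives a full row of \<open>Y\<close>, to which the row bound applies.\<close>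
      have "c j \<le> (\<Sum>i<k. (cmod (Y $$ (j, i)))\<^sup>2)"
        unfolding c_def by (rule sum_mono2) (use m in auto)
      with orthonormal_row_norm_le_1[OF Y YY that] show ?thesis by simp
    qed
    show "(\<Sum>j<n. c j) = real m"
      unfolding c_def using col m by (subst sum.swap) simp
  qed
  finally show ?thesis .
qed

section \<open>Compressions of the Hermitian part\<close>

lemma hermitian_part_carrier:
  "A \<in> carrier_mat n n \<Longrightarrow> hermitian_part A \<in> carrier_mat n n"
  by (simp add: hermitian_part_def mat_adjoint_carrier)

lemma mat_adjoint_hermitian_part:
  "A \<in> carrier_mat n n \<Longrightarrow> mat_adjoint (hermitian_part A) = hermitian_part A"
  by (rule eq_matI) (auto simp: hermitian_part_def)

text \<open>Compression commutes with taking Hermitian parts, and the diagonal entries of a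
  Hermitian part are the real parts of the original ones. This transfers the trace from
  \<open>A\<close> to its Hermitian part.\<close>

lemma Re_diag_hermitian_part:
  assumes A: "A \<in> carrier_mat n n" and Z: "Z \<in> carrier_mat n k" and i: "i < k"
  shows "Re ((mat_adjoint Z * hermitian_part A * Z) $$ (i, i)) = Re ((mat_adjoint Z * A * Z) $$ (i, i))"
proof -
  have A': "mat_adjoint A \<in> carrier_mat n n" and Z': "mat_adjoint Z \<in> carrier_mat k n"
    using A Z by (simp_all add: mat_adjoint_carrier)
  define T where "T = mat_adjoint Z * A * Z"
  have T: "T \<in> carrier_mat k k"
    unfolding T_def by (rule mult_carrier_mat[OF mult_carrier_mat[OF Z' A] Z])
  have T': "mat_adjoint T = mat_adjoint Z * mat_adjoint A * Z"
    unfolding T_def using mat_adjoint_mult[OF mult_carrier_mat[OF Z' A] Z]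
      mat_adjoint_mult[OF Z' A] A' Z Z' by simp
  have "mat_adjoint Z * hermitian_part A * Z = (1/2) \<cdot>\<^sub>m (T + mat_adjoint T)"
    unfolding T' unfolding T_def hermitian_part_def
    using mult_smult_distrib[OF Z' add_carrier_mat[OF A'], of "1/2" A]
      mult_add_distrib_mat[OF Z' A A']
      mult_smult_assoc_mat[of "mat_adjoint Z * A + mat_adjoint Z * mat_adjoint A" k n Z k "1/2"]
      add_mult_distrib_mat[OF mult_carrier_mat[OF Z' A] mult_carrier_mat[OF Z' A'] Z]
      mult_carrier_mat[OF Z' A] mult_carrier_mat[OF Z' A'] Z
    by (simp del: assoc_mult_mat)
  then show ?thesis
    using T i by (simp add: T_def[symmetric] del: index_mult_mat)
qed

section \<open>Bounding the number of unstable modes\<close>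

theorem corollary1:
  fixes A V :: "complex mat" and n k p :: nat and \<mu> M :: "nat \<Rightarrow> real"
  assumes A: "A \<in> carrier_mat n n"
    and stable: "stable_mat A"
    and \<mu>_eigenvalues:
      "{#complex_of_real (\<mu> j). j \<in># mset_set {1..n}#} = eigenvalues_mset (hermitian_part A)"
    and \<mu>_decreasing: "\<And>i j. 1 \<le> i \<Longrightarrow> i \<le> j \<Longrightarrow> j \<le> n \<Longrightarrow> \<mu> j \<le> \<mu> i"
    and M: "\<And>j. 1 \<le> j \<Longrightarrow> j \<le> n \<Longrightarrow> M j = (\<Sum>i=1..j. \<mu> i) / real j"
    and p: "p = (if M 1 < 0 then 0 else Max {j \<in> {1..n}. M j \<ge> 0})"
    and k: "1 \<le> k" "k \<le> n"
    and V: "V \<in> carrier_mat n k"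
    and V_orthonormal: "mat_adjoint V * V = 1\<^sub>m k"
  shows "num_unstable_modes (mat_adjoint V * A * V) \<le> p"
proof -
  define B where "B = mat_adjoint V * A * V"
  define m where "m = num_unstable_modes B"
  have V': "mat_adjoint V \<in> carrier_mat k n" using V by (simp add: mat_adjoint_carrier)
  have B: "B \<in> carrier_mat k k"
    unfolding B_def by (rule mult_carrier_mat[OF mult_carrier_mat[OF V' A] V])
  obtain as where as: "mset as = eigenvalues_mset B"
    using ex_mset by blast
  \<comment> \<open>Listing the unstable eigenvalues first puts them in the leading \<open>m\<close>
    diagonal positions of the Schur form \<open>T\<close>.\<close>
  define es where "es = filter (\<lambda>z. Re z \<ge> 0) as @ filter (\<lambda>z. \<not> Re z \<ge> 0) as"
  have es: "mset es = eigenvalues_mset B"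
  proof -
    have "mset es = mset as" unfolding es_def by (induction as) auto
    then show ?thesis using as by simp
  qed
  have m: "m = length (filter (\<lambda>z. Re z \<ge> 0) as)"
    by (simp add: m_def num_unstable_modes_def as[symmetric] flip: mset_filter)
  obtain U T where U: "U \<in> carrier_mat k k" and T: "T \<in> carrier_mat k k"
    and UU: "mat_adjoint U * U = 1\<^sub>m k" and UT: "mat_adjoint U * B * U = T"
    and dg: "diag_mat T = es"
    using unitary_schur[OF B char_poly_of_eigenvalues_mset[OF B es]] by blast
  have len: "length es = k" using dg T by (auto simp: diag_mat_def)
  then have mk: "m \<le> k" by (simp add: m es_def)
  have Re_T: "Re (T $$ (i, i)) \<ge> 0" if i: "i < m" for i
  proof -
    have "T $$ (i, i) = es ! i" using dg T i mk by (auto simp: diag_mat_def)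
    also have "\<dots> = filter (\<lambda>z. Re z \<ge> 0) as ! i" using i by (simp add: es_def m nth_append)
    also have "\<dots> \<in> set (filter (\<lambda>z. Re z \<ge> 0) as)" using i unfolding m by (rule nth_mem)
    finally show ?thesis by simp
  qed
  \<comment> \<open>The columns of \<open>Z\<close> form an orthonormal basis of the range of
    \<open>V\<close> in which the compression of \<open>A\<close> is the triangular matrix
    \<open>T\<close>. Its first \<open>m\<close> columns span the subspace to which Ky Fan's
    principle is applied.\<close>
  define Z where "Z = V * U"
  have U': "mat_adjoint U \<in> carrier_mat k k" using U by (simp add: mat_adjoint_carrier)
  have Z: "Z \<in> carrier_mat n k" unfolding Z_def by (rule mult_carrier_mat[OF V U])
  have adjZ: "mat_adjoint Z = mat_adjoint U * mat_adjoint V"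
    unfolding Z_def by (rule mat_adjoint_mult[OF V U])
  have "mat_adjoint Z * Z = mat_adjoint U * ((mat_adjoint V * V) * U)"
    unfolding adjZ unfolding Z_def
    by (simp add: assoc_mult_mat[OF U' V' mult_carrier_mat[OF V U]] assoc_mult_mat[OF V' V U])
  then have ZZ: "mat_adjoint Z * Z = 1\<^sub>m k" using V_orthonormal UU U by simp
  have "mat_adjoint Z * A * Z = mat_adjoint U * B * U"
    unfolding adjZ unfolding Z_def B_def using U' V' A V U
    by (simp add: assoc_mult_mat[of _ k k _ k _ k] assoc_mult_mat[of _ k k _ n _ k]
        assoc_mult_mat[of _ k n _ n _ k] assoc_mult_mat[of _ k n _ k _ k] assoc_mult_mat[of _ n n _ k _ k])
  then have ZT: "mat_adjoint Z * A * Z = T" using UT by simp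
  \<comment> \<open>The eigenvalues are numbered from 1 in the theorem but from 0 in the trace
    bound, hence the \<open>Suc\<close>.\<close>
  have ev: "mset (map (\<lambda>j. complex_of_real (\<mu> (Suc j))) [0..<n]) = eigenvalues_mset (hermitian_part A)"
  proof -
    have "mset_set {1..n} = image_mset Suc (mset_set {0..<n})"
      by (subst image_mset_mset_set) (auto simp: image_Suc_atLeastLessThan atLeastLessThanSuc_atLeastAtMost)
    then show ?thesis
      using \<mu>_eigenvalues by (simp add: multiset.map_comp o_def)
  qed
  have "0 \<le> (\<Sum>i<m. Re (T $$ (i, i)))" using Re_T by (auto intro: sum_nonneg)
  also have "\<dots> = (\<Sum>i<m. Re ((mat_adjoint Z * hermitian_part A * Z) $$ (i, i)))"
    using Re_diag_hermitian_part[OF A Z] mk by (intro sum.cong) (auto simp: ZT)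
  also have "\<dots> \<le> (\<Sum>j<m. \<mu> (Suc j))"
    using ky_fan_trace_le[OF hermitian_part_carrier[OF A] mat_adjoint_hermitian_part[OF A] ev _ Z ZZ mk]
      \<mu>_decreasing by simp
  also have "\<dots> = (\<Sum>i=1..m. \<mu> i)"
    by (simp add: sum.atLeast1_atMost_eq)
  finally have sum: "0 \<le> (\<Sum>i=1..m. \<mu> i)" .
  have "m \<le> p"
  proof (cases "m = 0")
    case False
    then have m1: "1 \<le> m" "m \<le> n" using mk k by auto
    \<comment> \<open>Since \<open>p\<close> is defined by cases, \<open>M 1\<close> must first be
      shown nonnegative: the largest eigenvalue is at least the average of the first
      \<open>m\<close>. Then \<open>m\<close> itself lies in the set whose maximum is
      \<open>p\<close>.\<close>
    have "(\<Sum>i=1..m. \<mu> i) \<le> (\<Sum>i=1..m. \<mu> 1)"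
      by (intro sum_mono \<mu>_decreasing) (use m1 in auto)
    then have "0 \<le> real m * \<mu> 1" using sum by simp
    then have "0 \<le> \<mu> 1" using m1 by (simp add: zero_le_mult_iff)
    then have "\<not> M 1 < 0" using M[of 1] k by simp
    moreover have "0 \<le> M m" using sum M m1 by simp
    ultimately show ?thesis using p m1 by (simp add: Max_ge)
  qed simp
  then show ?thesis by (simp add: m_def B_def)
qed

end
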